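(* Let $d\in\mathbb{N}$, let $a<b$ be real numbers, let $P_1=P_1^*\in\mathbb{R}^{d\times d}$ be invertible, $P_0=-P_0^*\in\mathbb{R}^{d\times d}$, and let $\mathcal{H}\in L_\infty(a,b;\mathbb{R}^{d\times d})$ satisfy $\mathcal{H}(x)=\mathcal{H}(x)^*\ge m$ for some $m>0$. Let $$E_+:=\operatorname{span}\{x\in\mathbb{R}^d\,;\ \exists\lambda>0:\ P_1x=\lambda x\}.$$ For $t\in\mathbb{R}$ let $\Phi_t\colon[a,b]\to\mathbb{C}^{d\times d}$ be the fundamental matrix of $$u'(x)=P_1^{-1}\big(\mathrm{i}t\mathcal{H}(x)^{-1}-P_0\big)u(x)\in\mathbb{C}^d\quad(x\in(a,b))$$ with $\Phi_t(a)=1_d$. Assume that for almost every $x\in(a,b)$ $$\mathcal{H}(x)[E_+]\subseteq E_+.$$ Then $\sup_{t\in\mathbb{R}}\|\Phi_t\|_\infty<\infty$.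
   Context: $1_d$ is the $d\times d$ identity matrix; $\|\Phi_t\|_\infty=\sup_{x\in[a,b]}\|\Phi_t(x)\|$. Inequalities between matrices are in the sense of positive definiteness. The fundamental matrix $\Phi_t$ is the matrix-valued (absolutely continuous) solution of the ODE with the stated initial value. *)

theory Defs
  imports "HOL-Analysis.Analysis"
begin

(* The members K of a division of a set of reals are nonoverlapping nonempty compact intervals
   [Inf K, Sup K]; degenerate ones contribute 0 to both sums. *)
definition absolutely_continuous_on_interval ::
    "real \<Rightarrow> real \<Rightarrow> (real \<Rightarrow> 'a::real_normed_vector) \<Rightarrow> bool" where
  "absolutely_continuous_on_interval a b f \<longleftrightarrow>
     (\<forall>\<epsilon>>0. \<exists>\<delta>>0. \<forall>D S. D division_of S \<and> S \<subseteq> {a..b} \<and> (\<Sum>K\<in>D. Sup K - Inf K) < \<delta> \<longrightarrow>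
        (\<Sum>K\<in>D. norm (f (Sup K) - f (Inf K))) < \<epsilon>)"

(* Representatives of classes in L_infinity; the choice of norm on the matrix space is immaterial. *)
definition Linfty :: "'a measure \<Rightarrow> ('a \<Rightarrow> 'b::real_normed_vector) \<Rightarrow> bool" where
  "Linfty M f \<longleftrightarrow> f \<in> borel_measurable M \<and> (\<exists>C. AE x in M. norm (f x) \<le> C)"

definition pos_semidef :: "real^'n^'n \<Rightarrow> bool" where
  "pos_semidef A \<longleftrightarrow> transpose A = A \<and> (\<forall>v. 0 \<le> v \<bullet> (A *v v))"

definition matrix_le :: "real^'n^'n \<Rightarrow> real^'n^'n \<Rightarrow> bool" where
  "matrix_le A B \<longleftrightarrow> pos_semidef (B - A)"

definition E_plus :: "real^'n^'n \<Rightarrow> (real^'n) set" where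
  "E_plus P1 = span {x. \<exists>l>0. P1 *v x = l *\<^sub>R x}"

abbreviation complexify :: "real^'n^'n \<Rightarrow> complex^'n^'n" where
  "complexify \<equiv> map_matrix complex_of_real"

definition ode_coeff ::
    "real^'n^'n \<Rightarrow> real^'n^'n \<Rightarrow> (real \<Rightarrow> real^'n^'n) \<Rightarrow> real \<Rightarrow> real \<Rightarrow> complex^'n^'n" where
  "ode_coeff P1 P0 H t x =
     complexify (matrix_inv P1) **
       (mat (\<i> * complex_of_real t) ** complexify (matrix_inv (H x)) - complexify P0)"

(* Caratheodory solution; the values of the function outside [a,b] play no role. *)
definition fundamental_matrix ::
    "real \<Rightarrow> real \<Rightarrow> (real \<Rightarrow> complex^'n^'n) \<Rightarrow> (real \<Rightarrow> complex^'n^'n) \<Rightarrow> bool" where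
  "fundamental_matrix a b A \<Phi> \<longleftrightarrow>
     absolutely_continuous_on_interval a b \<Phi> \<and>
     (AE x in lebesgue_on {a<..<b}. (\<Phi> has_vector_derivative A x ** \<Phi> x) (at x)) \<and>
     \<Phi> a = mat 1"

(* Taken in the extended reals because SUP of an unbounded set of reals is an arbitrary real. *)
definition matrix_sup_norm :: "real \<Rightarrow> real \<Rightarrow> (real \<Rightarrow> complex^'n^'n) \<Rightarrow> ereal" where
  "matrix_sup_norm a b \<Phi> = (SUP x\<in>{a..b}. ereal (onorm ((*v) (\<Phi> x))))"

end

theory Submission
  imports Defs
begin

text \<open>The proof is an energy estimate. Let \<open>J\<close> be the reflection that fixes \<open>E\<^sub>+\<close> and negates its
orthogonal complement. Since \<open>P\<^sub>1\<close> is symmetric and invertible, it is positive definite on \<open>E\<^sub>+\<close> and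
negative definite on the complement, so \<open>Q = J P\<^sub>1\<close> is symmetric and positive definite
(\<open>abs_matrix_exists\<close>). Consequently the energy \<open>\<langle>Q u, u\<rangle>\<close> of a solution \<open>u\<close> is comparable with
\<open>\<parallel>u\<parallel>\<^sup>2\<close>, with constants that do not depend on \<open>t\<close>.

Along a solution the energy has the derivative \<open>2 Re \<langle>J (\<i> t H\<^sup>-\<^sup>1 - P\<^sub>0) u, u\<rangle>\<close>. By assumption \<open>H\<close>
preserves \<open>E\<^sub>+\<close>, hence by symmetry also its complement; therefore \<open>J\<close> commutes with \<open>H\<close> and
\<open>J H\<^sup>-\<^sup>1\<close> is symmetric. The term with \<open>t\<close> thus vanishes (\<open>energy_derivative\<close>), and what remains
is bounded by a multiple, independent of \<open>t\<close>, of the energy. Gronwall's inequality finishes the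
proof (\<open>energy_growth_imp_bound\<close>).

The differential equation holds only almost everywhere. Gronwall's inequality is therefore derived
from the fact that an absolutely continuous function with nonpositive derivative almost everywhere
does not increase (\<open>absolutely_continuous_on_interval_nonincreasing\<close>), which is proved directly with
a gauge.\<close>

section \<open>Absolutely continuous functions and Gronwall's inequality\<close>

lemma division_endpoints:
  fixes K :: "real set"
  assumes "D division_of S" "S \<subseteq> {a..b}" "K \<in> D"
  shows "Inf K \<in> {a..b}" "Sup K \<in> {a..b}" "Inf K \<le> Sup K"
proof -
  obtain u v where uv: "K = cbox u v" "K \<noteq> {}"
    using division_ofD(3)[OF assms(1,3)] division_ofD(4)[OF assms(1,3)] by blast
  then have K: "K = {u..v}" "u \<le> v"
    by (auto simp: box_real)
  have "K \<subseteq> {a..b}"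
    using division_ofD(2)[OF assms(1,3)] assms(2) by blast
  then show "Inf K \<in> {a..b}" "Sup K \<in> {a..b}" "Inf K \<le> Sup K"
    using K by auto
qed

lemma absolutely_continuous_on_interval_subset:
  assumes "absolutely_continuous_on_interval a b f" "a \<le> c" "d \<le> b"
  shows "absolutely_continuous_on_interval c d f"
proof -
  have "{c..d} \<subseteq> {a..b}"
    using assms(2,3) by auto
  then show ?thesis
    using assms(1) unfolding absolutely_continuous_on_interval_def by (meson order_trans)
qed

lemma absolutely_continuous_on_interval_imp_continuous_on:
  assumes "absolutely_continuous_on_interval a b f"
  shows "continuous_on {a..b} f"
  unfolding continuous_on_iff
proof (intro ballI allI impI)
  fix x e :: real
  assume x: "x \<in> {a..b}" and "e > 0"
  then obtain \<delta> where "\<delta> > 0"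
    and \<delta>: "\<And>D S. \<lbrakk>D division_of S; S \<subseteq> {a..b}; (\<Sum>K\<in>D. Sup K - Inf K) < \<delta>\<rbrakk>
            \<Longrightarrow> (\<Sum>K\<in>D. norm (f (Sup K) - f (Inf K))) < e"
    using assms unfolding absolutely_continuous_on_interval_def by meson
  have "dist (f y) (f x) < e" if y: "y \<in> {a..b}" "dist y x < \<delta>" for y
  proof -
    let ?K = "{min x y..max x y}"
    have "{?K} division_of ?K"
      using division_of_self[of "min x y" "max x y"] by (auto simp: box_real)
    moreover have "?K \<subseteq> {a..b}"
      using x y by auto
    moreover have "(\<Sum>K\<in>{?K}. Sup K - Inf K) < \<delta>"
      using y by (auto simp: dist_real_def)
    ultimately have "(\<Sum>K\<in>{?K}. norm (f (Sup K) - f (Inf K))) < e"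
      by (rule \<delta>)
    then have "norm (f (max x y) - f (min x y)) < e"
      by simp
    then show ?thesis
      by (auto simp: dist_norm max_def min_def norm_minus_commute split: if_splits)
  qed
  then show "\<exists>d>0. \<forall>y\<in>{a..b}. dist y x < d \<longrightarrow> dist (f y) (f x) < e"
    using \<open>\<delta> > 0\<close> by blast
qed

lemma absolutely_continuous_on_interval_bounded:
  assumes "absolutely_continuous_on_interval a b f"
  obtains B where "B > 0" "\<And>x. x \<in> {a..b} \<Longrightarrow> norm (f x) \<le> B"
proof -
  have "bounded (f ` {a..b})"
    using absolutely_continuous_on_interval_imp_continuous_on[OF assms]
    by (intro compact_imp_bounded compact_continuous_image) auto
  then show ?thesis
    using that by (auto simp: bounded_pos)
qed

lemma Lipschitz_imp_absolutely_continuous_on_interval: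
  assumes "\<And>x y. \<lbrakk>x \<in> {a..b}; y \<in> {a..b}; x \<le> y\<rbrakk> \<Longrightarrow> norm (f y - f x) \<le> L * (y - x)"
  shows "absolutely_continuous_on_interval a b f"
  unfolding absolutely_continuous_on_interval_def
proof (intro allI impI)
  fix e :: real assume "e > 0"
  define M where "M = \<bar>L\<bar> + 1"
  have M: "M > 0" "L \<le> M"
    by (auto simp: M_def)
  have "(\<Sum>K\<in>D. norm (f (Sup K) - f (Inf K))) < e"
    if D: "D division_of S" "S \<subseteq> {a..b}" "(\<Sum>K\<in>D. Sup K - Inf K) < e / M" for D S
  proof -
    have "norm (f (Sup K) - f (Inf K)) \<le> M * (Sup K - Inf K)" if "K \<in> D" for K
    proof -
      note K = division_endpoints[OF D(1,2) that]
      have "L * (Sup K - Inf K) \<le> M * (Sup K - Inf K)"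
        using K M by (intro mult_right_mono) auto
      then show ?thesis
        using assms[OF K] by linarith
    qed
    then have "(\<Sum>K\<in>D. norm (f (Sup K) - f (Inf K))) \<le> (\<Sum>K\<in>D. M * (Sup K - Inf K))"
      by (rule sum_mono)
    also have "\<dots> = M * (\<Sum>K\<in>D. Sup K - Inf K)"
      by (simp add: sum_distrib_left)
    also have "\<dots> < e"
      using D(3) M by (simp add: field_simps)
    finally show ?thesis .
  qed
  moreover have "e / M > 0"
    using \<open>e > 0\<close> M by simp
  ultimately show "\<exists>\<delta>>0. \<forall>D S. D division_of S \<and> S \<subseteq> {a..b} \<and> (\<Sum>K\<in>D. Sup K - Inf K) < \<delta> \<longrightarrow>
        (\<Sum>K\<in>D. norm (f (Sup K) - f (Inf K))) < e"
    by blast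
qed

lemma (in bounded_bilinear) absolutely_continuous_on_interval:
  assumes f: "absolutely_continuous_on_interval a b f"
    and g: "absolutely_continuous_on_interval a b g"
  shows "absolutely_continuous_on_interval a b (\<lambda>x. prod (f x) (g x))"
  unfolding absolutely_continuous_on_interval_def
proof (intro allI impI)
  fix e :: real assume "e > 0"
  obtain K where "K > 0" and K: "\<And>u v. norm (prod u v) \<le> norm u * norm v * K"
    using pos_bounded by blast
  obtain F where F: "F > 0" "\<And>x. x \<in> {a..b} \<Longrightarrow> norm (f x) \<le> F"
    using absolutely_continuous_on_interval_bounded[OF f] by blast
  obtain G where G: "G > 0" "\<And>x. x \<in> {a..b} \<Longrightarrow> norm (g x) \<le> G"
    using absolutely_continuous_on_interval_bounded[OF g] by blast
  have pos: "e / (2 * K * G) > 0" "e / (2 * K * F) > 0"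
    using \<open>e > 0\<close> \<open>K > 0\<close> F G by auto
  obtain \<delta>1 where "\<delta>1 > 0"
    and \<delta>1: "\<And>D S. \<lbrakk>D division_of S; S \<subseteq> {a..b}; (\<Sum>K\<in>D. Sup K - Inf K) < \<delta>1\<rbrakk>
            \<Longrightarrow> (\<Sum>K\<in>D. norm (f (Sup K) - f (Inf K))) < e / (2 * K * G)"
    using f pos(1) unfolding absolutely_continuous_on_interval_def by meson
  obtain \<delta>2 where "\<delta>2 > 0"
    and \<delta>2: "\<And>D S. \<lbrakk>D division_of S; S \<subseteq> {a..b}; (\<Sum>K\<in>D. Sup K - Inf K) < \<delta>2\<rbrakk>
            \<Longrightarrow> (\<Sum>K\<in>D. norm (g (Sup K) - g (Inf K))) < e / (2 * K * F)"
    using g pos(2) unfolding absolutely_continuous_on_interval_def by meson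
  have "(\<Sum>I\<in>D. norm (prod (f (Sup I)) (g (Sup I)) - prod (f (Inf I)) (g (Inf I)))) < e"
    if D: "D division_of S" "S \<subseteq> {a..b}" "(\<Sum>I\<in>D. Sup I - Inf I) < min \<delta>1 \<delta>2" for D S
  proof -
    have "norm (prod (f (Sup I)) (g (Sup I)) - prod (f (Inf I)) (g (Inf I)))
        \<le> K * G * norm (f (Sup I) - f (Inf I)) + K * F * norm (g (Sup I) - g (Inf I))"
      if "I \<in> D" for I
    proof -
      note I = division_endpoints[OF D(1,2) that]
      have "prod (f (Sup I)) (g (Sup I)) - prod (f (Inf I)) (g (Inf I))
          = prod (f (Sup I) - f (Inf I)) (g (Sup I)) + prod (f (Inf I)) (g (Sup I) - g (Inf I))"
        by (simp add: diff_left diff_right)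
      also have "norm \<dots> \<le> norm (f (Sup I) - f (Inf I)) * norm (g (Sup I)) * K
          + norm (f (Inf I)) * norm (g (Sup I) - g (Inf I)) * K"
        by (intro norm_triangle_le add_mono K)
      also have "\<dots> \<le> norm (f (Sup I) - f (Inf I)) * G * K
          + F * norm (g (Sup I) - g (Inf I)) * K"
        using F(2)[OF I(1)] G(2)[OF I(2)] \<open>K > 0\<close>
        by (intro add_mono mult_right_mono mult_left_mono) auto
      finally show ?thesis
        by (simp add: mult_ac)
    qed
    then have "(\<Sum>I\<in>D. norm (prod (f (Sup I)) (g (Sup I)) - prod (f (Inf I)) (g (Inf I))))
        \<le> (\<Sum>I\<in>D. K * G * norm (f (Sup I) - f (Inf I)) + K * F * norm (g (Sup I) - g (Inf I)))"
      by (rule sum_mono)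
    also have "\<dots> = K * G * (\<Sum>I\<in>D. norm (f (Sup I) - f (Inf I)))
        + K * F * (\<Sum>I\<in>D. norm (g (Sup I) - g (Inf I)))"
      by (simp add: sum.distrib sum_distrib_left)
    also have "\<dots> < K * G * (e / (2 * K * G)) + K * F * (e / (2 * K * F))"
      using D \<open>K > 0\<close> F G \<delta>1[OF D(1,2)] \<delta>2[OF D(1,2)]
      by (intro add_strict_mono mult_strict_left_mono) auto
    also have "\<dots> = e"
      using \<open>K > 0\<close> F G by (simp add: field_simps)
    finally show ?thesis .
  qed
  moreover have "min \<delta>1 \<delta>2 > 0"
    using \<open>\<delta>1 > 0\<close> \<open>\<delta>2 > 0\<close> by simp
  ultimately show "\<exists>\<delta>>0. \<forall>D S. D division_of S \<and> S \<subseteq> {a..b} \<and> (\<Sum>K\<in>D. Sup K - Inf K) < \<delta> \<longrightarrow>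
        (\<Sum>K\<in>D. norm (prod (f (Sup K)) (g (Sup K)) - prod (f (Inf K)) (g (Inf K)))) < e"
    by blast
qed

text \<open>The members of a division overlap only in endpoints, so their lengths add up to the measure of
their union.\<close>

lemma division_sum_length_le_measure:
  fixes D :: "real set set"
  assumes D: "D division_of S" "S \<subseteq> U" "U \<in> lmeasurable"
  shows "(\<Sum>K\<in>D. Sup K - Inf K) \<le> measure lebesgue U"
proof -
  note div = division_ofD[OF D(1)]
  have K: "K \<in> lmeasurable \<and> measure lebesgue K = Sup K - Inf K" if KD: "K \<in> D" for K
  proof -
    obtain u v where "K = cbox u v" "K \<noteq> {}"
      using div(3)[OF KD] div(4)[OF KD] by blast
    then show ?thesis
      by (auto simp: box_real)
  qed
  have "negligible (K \<inter> L)" if KL: "K \<in> D" "L \<in> D" "K \<noteq> L" for K L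
  proof -
    obtain u v u' v' where "K = cbox u v" "L = cbox u' v'"
      using div(4) KL by meson
    moreover have "interior K \<inter> interior L = {}"
      using div(5) KL by blast
    ultimately have KL: "K = cbox u v" "L = cbox u' v'" "box u v \<inter> box u' v' = {}"
      by simp_all
    show ?thesis
      using KL(3) unfolding KL(1,2) Int_interval negligible_interval box_Int_box .
  qed
  then have "(\<Sum>K\<in>D. measure lebesgue K) = measure lebesgue (\<Union>D)"
    using K div(1) by (intro measure_negligible_finite_Union[symmetric]) (auto simp: pairwise_def)
  also have "\<dots> \<le> measure lebesgue U"
    using D(2,3) div(1,6) K by (intro measure_mono_fmeasurable fmeasurableD fmeasurable.finite_Union) auto
  finally show ?thesis
    using K by simp
qed

text \<open>The straddle lemma in one-sided form: the first-order estimates at two points on either side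
of \<open>x\<close> combine without any control on the ratio of their distances to \<open>x\<close>.\<close>

lemma has_real_derivative_nonpos_imp_straddle:
  fixes f :: "real \<Rightarrow> real"
  assumes f: "(f has_real_derivative d) (at x)" "d \<le> 0" and "e > 0"
  shows "\<exists>r>0. \<forall>u v. u \<le> x \<and> x \<le> v \<and> {u..v} \<subseteq> ball x r \<longrightarrow> f v - f u \<le> e * (v - u)"
proof -
  have "(f has_derivative (*) d) (at x)"
    using f(1) by (simp add: has_field_derivative_def)
  then obtain r where "r > 0"
    and r: "\<And>y. \<bar>y - x\<bar> < r \<Longrightarrow> \<bar>f y - f x - d * (y - x)\<bar> \<le> e * \<bar>y - x\<bar>"
    using \<open>e > 0\<close> unfolding has_derivative_at_alt by (metis real_norm_def)
  have "f v - f u \<le> e * (v - u)" if "u \<le> x" "x \<le> v" "{u..v} \<subseteq> ball x r" for u v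
  proof -
    have "u \<in> ball x r" "v \<in> ball x r"
      using that(1,2) subsetD[OF that(3), of u] subsetD[OF that(3), of v] by (simp_all del: mem_ball)
    then have "\<bar>f v - f x - d * (v - x)\<bar> \<le> e * (v - x)" "\<bar>f u - f x - d * (u - x)\<bar> \<le> e * (x - u)"
      using r[of v] r[of u] that by (auto simp: dist_real_def)
    then have "f v - f u \<le> d * (v - u) + e * (v - u)"
      by (simp add: algebra_simps abs_le_iff)
    moreover have "d * (v - u) \<le> 0"
      using f(2) that by (intro mult_nonpos_nonneg) auto
    ultimately show ?thesis
      by linarith
  qed
  then show ?thesis
    using \<open>r > 0\<close> by blast
qed

text \<open>Absolute continuity is what rules out Cantor-type behaviour on the exceptional null set \<open>N\<close>.
Cover \<open>N\<close> by an open set \<open>U\<close> of measure less than the \<open>\<delta>\<close> that belongs to \<open>e\<close>, and take a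
tagged division of \<open>[a,b]\<close> whose intervals with tag in \<open>N\<close> lie in \<open>U\<close>, while those with tag
outside \<open>N\<close> are so short that the straddle lemma applies. The increments of the first kind sum to
less than \<open>e\<close> by absolute continuity, those of the second kind to at most \<open>e * (b - a)\<close>.\<close>

lemma absolutely_continuous_on_interval_nonincreasing:
  fixes f :: "real \<Rightarrow> real"
  assumes "a \<le> b" and ac: "absolutely_continuous_on_interval a b f"
    and deriv: "AE x in lebesgue_on {a<..<b}. \<exists>d\<le>0. (f has_real_derivative d) (at x)"
  shows "f b \<le> f a"
proof (rule field_le_epsilon)
  fix e' :: real assume "e' > 0"
  (* The budget e' is shared: e for the tags in N and e * (b - a) for the others. *)
  define e where "e = e' / (b - a + 1)"
  have e: "e > 0" "e * (b - a) + e = e'"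
  proof -
    have "b - a + 1 > 0"
      using \<open>a \<le> b\<close> by simp
    then show "e > 0" "e * (b - a) + e = e'"
      using \<open>e' > 0\<close> by (simp_all add: e_def add_divide_distrib[symmetric] flip: distrib_left)
        (simp add: field_simps)
  qed
  obtain \<delta> where "\<delta> > 0"
    and \<delta>: "\<And>D S. \<lbrakk>D division_of S; S \<subseteq> {a..b}; (\<Sum>K\<in>D. Sup K - Inf K) < \<delta>\<rbrakk>
            \<Longrightarrow> (\<Sum>K\<in>D. norm (f (Sup K) - f (Inf K))) < e"
    using ac e unfolding absolutely_continuous_on_interval_def by meson
  (* Nothing is known at a and b, so N may contain them. *)
  define N where "N = {x \<in> {a..b}. \<not> (\<exists>d\<le>0. (f has_real_derivative d) (at x))}"
  have "AE x in lebesgue. x \<in> {a<..<b} \<longrightarrow> (\<exists>d\<le>0. (f has_real_derivative d) (at x))"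
    using deriv by (simp add: AE_restrict_space_iff)
  then have "negligible {x. \<not> (x \<in> {a<..<b} \<longrightarrow> (\<exists>d\<le>0. (f has_real_derivative d) (at x)))}"
    by (simp add: completion.AE_iff_null_sets negligible_iff_null_sets)
  then have "negligible ({a, b} \<union> {x. \<not> (x \<in> {a<..<b} \<longrightarrow> (\<exists>d\<le>0. (f has_real_derivative d) (at x)))})"
    by (intro negligible_Un) auto
  then have N: "negligible N"
    by (rule negligible_subset) (auto simp: N_def)
  obtain U where U: "open U" "N \<subseteq> U" "U - N \<in> lmeasurable" "emeasure lebesgue (U - N) < ennreal \<delta>"
    using sets_lebesgue_outer_open[OF negligible_imp_sets[OF N] \<open>\<delta> > 0\<close>] by blast
  have "N \<in> lmeasurable" "measure lebesgue N = 0"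
    using N by (auto simp: negligible_imp_measurable negligible_imp_measure0)
  moreover have "measure lebesgue (U - N) < \<delta>"
    using U(3,4) by (simp add: emeasure_eq_measure2 ennreal_less_iff)
  moreover have "U = (U - N) \<union> N"
    using U(2) by blast
  ultimately have Um: "U \<in> lmeasurable" "measure lebesgue U < \<delta>"
    using fmeasurable.Un[of "U - N" lebesgue N] measure_Un_le[of "U - N" lebesgue N] U(3)
    by (simp_all add: fmeasurableD)
  have "\<exists>r>0. \<forall>u v. u \<le> x \<and> x \<le> v \<and> {u..v} \<subseteq> ball x r \<longrightarrow> f v - f u \<le> e * (v - u)"
    if "x \<in> {a..b} - N" for x
    using that has_real_derivative_nonpos_imp_straddle[OF _ _ e(1)] unfolding N_def by blast
  then obtain r where r: "\<And>x. x \<in> {a..b} - N \<Longrightarrow> r x > 0"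
    "\<And>x u v. \<lbrakk>x \<in> {a..b} - N; u \<le> x; x \<le> v; {u..v} \<subseteq> ball x (r x)\<rbrakk> \<Longrightarrow> f v - f u \<le> e * (v - u)"
    by metis
  define \<gamma> where "\<gamma> x = (if x \<in> N then U else if x \<in> {a..b} then ball x (r x) else UNIV)" for x
  have "gauge \<gamma>"
    using U r(1) by (auto simp: gauge_def \<gamma>_def)
  then obtain p where p: "p tagged_division_of {a..b}" "\<gamma> fine p"
    by (rule fine_division_exists_real)
  note pD = tagged_division_ofD[OF p(1)]
  define p1 where "p1 = {(x, K) \<in> p. x \<in> N}"
  define p2 where "p2 = {(x, K) \<in> p. x \<notin> N}"
  have split: "p = p1 \<union> p2" "p1 \<inter> p2 = {}"
    by (auto simp: p1_def p2_def)
  then have fin: "finite p1" "finite p2"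
    using pD(1) by (auto simp: split(1))
  have K: "K \<noteq> {} \<and> {Inf K..Sup K} = K \<and> Inf K \<le> x \<and> x \<le> Sup K \<and> x \<in> {a..b} \<and> Inf K \<le> Sup K"
    if xK: "(x, K) \<in> p" for x K
  proof -
    obtain u v where "K = cbox u v"
      using pD(4)[OF xK] by blast
    moreover have "x \<in> K" "K \<subseteq> {a..b}"
      using pD(2,3)[OF xK] by auto
    ultimately show ?thesis
      by (auto simp: box_real)
  qed
  have p1: "p1 tagged_division_of \<Union>(snd ` p1)"
  proof (rule tagged_partial_division_of_Union_self)
    have "p tagged_partial_division_of {a..b}"
      using p(1) by (simp add: tagged_division_of_def)
    then show "p1 tagged_partial_division_of {a..b}"
      by (rule tagged_partial_division_subset) (auto simp: p1_def)
  qed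
  (* Inf {} and Sup {} are arbitrary reals, but the passage from tagged intervals to intervals
     needs a summand that vanishes on the empty interval. *)
  define osc where "osc K = (if K = {} then 0 else norm (f (Sup K) - f (Inf K)))" for K
  have "(\<Sum>(x, K)\<in>p1. f (Sup K) - f (Inf K)) \<le> (\<Sum>(x, K)\<in>p1. norm (f (Sup K) - f (Inf K)))"
    by (rule sum_mono) auto
  also have "(\<Sum>(x, K)\<in>p1. norm (f (Sup K) - f (Inf K))) = (\<Sum>(x, K)\<in>p1. osc K)"
    using K by (intro sum.cong) (auto simp: osc_def p1_def)
  also have "\<dots> = (\<Sum>K\<in>snd ` p1. osc K)"
  proof (rule sum.over_tagged_division_lemma[OF p1])
    fix u v :: real assume "box u v = {}"
    then have "v \<le> u"
      by simp
    then show "osc (cbox u v) = 0"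
      by (cases "u = v") (auto simp: osc_def box_real)
  qed
  also have "\<dots> = (\<Sum>K\<in>snd ` p1. norm (f (Sup K) - f (Inf K)))"
    using K by (intro sum.cong) (auto simp: osc_def p1_def)
  also have "\<dots> < e"
  proof (rule \<delta>)
    show div: "snd ` p1 division_of \<Union>(snd ` p1)"
      using p1 by (rule division_of_tagged_division)
    show "\<Union>(snd ` p1) \<subseteq> {a..b}"
      using pD(3) by (fastforce simp: p1_def)
    have "\<Union>(snd ` p1) \<subseteq> U"
      using p(2) by (fastforce simp: p1_def fine_def \<gamma>_def)
    then show "(\<Sum>K\<in>snd ` p1. Sup K - Inf K) < \<delta>"
      using division_sum_length_le_measure[OF div _ Um(1)] Um(2) by linarith
  qed
  finally have 1: "(\<Sum>(x, K)\<in>p1. f (Sup K) - f (Inf K)) < e" .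
  have "(\<Sum>(x, K)\<in>p2. f (Sup K) - f (Inf K)) \<le> (\<Sum>(x, K)\<in>p2. e * (Sup K - Inf K))"
  proof (rule sum_mono, clarify)
    fix x K assume "(x, K) \<in> p2"
    then have xK: "(x, K) \<in> p" "x \<notin> N"
      by (auto simp: p2_def)
    then have "K \<subseteq> ball x (r x)"
      using p(2) K[of x K] unfolding fine_def \<gamma>_def by force
    then show "f (Sup K) - f (Inf K) \<le> e * (Sup K - Inf K)"
      using K[OF xK(1)] xK(2) by (intro r(2)[of x]) auto
  qed
  also have "\<dots> \<le> (\<Sum>(x, K)\<in>p. e * (Sup K - Inf K))"
  proof (rule sum_mono2)
    show "0 \<le> (case y of (x, K) \<Rightarrow> e * (Sup K - Inf K))" if "y \<in> p - p2" for y
    proof (cases y)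
      case (Pair x K)
      then have "Inf K \<le> Sup K"
        using K that by blast
      then show ?thesis
        using Pair e(1) by simp
    qed
  qed (use split(1) pD(1) in auto)
  also have "\<dots> = e * (\<Sum>(x, K)\<in>p. Sup K - Inf K)"
    by (simp add: sum_distrib_left split_def)
  also have "\<dots> = e * (b - a)"
    using additive_tagged_division_1[OF \<open>a \<le> b\<close> p(1), of "\<lambda>x. x"] by simp
  finally have 2: "(\<Sum>(x, K)\<in>p2. f (Sup K) - f (Inf K)) \<le> e * (b - a)" .
  have "f b - f a = (\<Sum>(x, K)\<in>p. f (Sup K) - f (Inf K))"
    using additive_tagged_division_1[OF \<open>a \<le> b\<close> p(1), of f] by simp
  also have "\<dots> = (\<Sum>(x, K)\<in>p1. f (Sup K) - f (Inf K)) + (\<Sum>(x, K)\<in>p2. f (Sup K) - f (Inf K))"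
    unfolding split(1) by (rule sum.union_disjoint[OF fin split(2)])
  finally show "f b \<le> f a + e'"
    using 1 2 e(2) by linarith
qed

lemma absolutely_continuous_on_interval_exp:
  "absolutely_continuous_on_interval a b (\<lambda>x. exp (c * x) :: real)"
proof (rule Lipschitz_imp_absolutely_continuous_on_interval)
  fix x y assume xy: "x \<in> {a..b}" "y \<in> {a..b}" "x \<le> y"
  have "norm (exp (c * y) - exp (c * x)) \<le> \<bar>c\<bar> * exp (\<bar>c\<bar> * max \<bar>a\<bar> \<bar>b\<bar>) * norm (y - x)"
  proof (rule field_differentiable_bound[of "{a..b}" "\<lambda>x. exp (c * x)" "\<lambda>x. c * exp (c * x)"])
    fix z assume z: "z \<in> {a..b}"
    show "((\<lambda>x. exp (c * x)) has_field_derivative c * exp (c * z)) (at z within {a..b})"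
      by (auto intro!: derivative_eq_intros)
    have "c * z \<le> \<bar>c\<bar> * \<bar>z\<bar>"
      by (metis abs_ge_self abs_mult)
    also have "\<dots> \<le> \<bar>c\<bar> * max \<bar>a\<bar> \<bar>b\<bar>"
      using z by (intro mult_left_mono) auto
    finally show "norm (c * exp (c * z)) \<le> \<bar>c\<bar> * exp (\<bar>c\<bar> * max \<bar>a\<bar> \<bar>b\<bar>)"
      by (auto simp: abs_mult intro!: mult_left_mono)
  qed (use xy in auto)
  then show "norm (exp (c * y) - exp (c * x)) \<le> \<bar>c\<bar> * exp (\<bar>c\<bar> * max \<bar>a\<bar> \<bar>b\<bar>) * (y - x)"
    using xy by simp
qed

text \<open>The function \<open>exp (- c * y) * f y\<close> is absolutely continuous with nonpositive derivative almost
everywhere.\<close>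

lemma absolutely_continuous_on_interval_gronwall:
  fixes f f' :: "real \<Rightarrow> real"
  assumes ac: "absolutely_continuous_on_interval a b f"
    and deriv: "AE x in lebesgue_on {a<..<b}. (f has_real_derivative f' x) (at x) \<and> f' x \<le> c * f x"
    and x: "x \<in> {a..b}"
  shows "f x \<le> exp (c * (x - a)) * f a"
proof -
  define g where "g y = exp (- c * y) * f y" for y
  have "absolutely_continuous_on_interval a b g"
    unfolding g_def
    by (intro bounded_bilinear.absolutely_continuous_on_interval[OF bounded_bilinear_mult]
        absolutely_continuous_on_interval_exp ac)
  then have ac_g: "absolutely_continuous_on_interval a x g"
    using x by (auto intro: absolutely_continuous_on_interval_subset)
  have deriv_g: "AE y in lebesgue_on {a<..<x}. \<exists>d\<le>0. (g has_real_derivative d) (at y)"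
  proof -
    have "AE y in lebesgue. y \<in> {a<..<b} \<longrightarrow> (f has_real_derivative f' y) (at y) \<and> f' y \<le> c * f y"
      using deriv by (subst (asm) AE_restrict_space_iff) auto
    then have "AE y in lebesgue. y \<in> {a<..<x} \<longrightarrow> (\<exists>d\<le>0. (g has_real_derivative d) (at y))"
    proof (eventually_elim, intro impI)
      fix y assume y: "y \<in> {a<..<b} \<longrightarrow> (f has_real_derivative f' y) (at y) \<and> f' y \<le> c * f y"
        and "y \<in> {a<..<x}"
      with x have f: "(f has_real_derivative f' y) (at y)" "f' y \<le> c * f y"
        by auto
      have "(g has_real_derivative exp (- c * y) * (f' y - c * f y)) (at y)"
        unfolding g_def by (auto intro!: derivative_eq_intros f(1) simp: algebra_simps)
      moreover have "exp (- c * y) * (f' y - c * f y) \<le> 0"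
        using f(2) by (intro mult_nonneg_nonpos) auto
      ultimately show "\<exists>d\<le>0. (g has_real_derivative d) (at y)"
        by blast
    qed
    then show ?thesis
      by (simp add: AE_restrict_space_iff)
  qed
  have "g x \<le> g a"
    using x by (intro absolutely_continuous_on_interval_nonincreasing[OF _ ac_g deriv_g]) simp
  then have "exp (c * x) * g x \<le> exp (c * x) * g a"
    by (intro mult_left_mono) auto
  moreover have "exp (c * x) * g x = f x"
    by (simp add: g_def exp_minus)
  moreover have "exp (c * x) * g a = exp (c * (x - a)) * f a"
    by (simp add: g_def right_diff_distrib exp_diff exp_minus divide_inverse)
  ultimately show ?thesis
    by simp
qed

section \<open>Symmetric matrices and the absolute value of an invertible one\<close>

lemma symmetric_matrix_inner:
  fixes A :: "real^'n^'n"
  assumes "transpose A = A"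
  shows "(A *v x) \<bullet> y = x \<bullet> (A *v y)"
proof -
  have "A *v x = x v* A"
    by (subst assms[symmetric]) (rule transpose_matrix_vector)
  then show ?thesis
    by (simp add: dot_lmul_matrix)
qed

lemma inner_symmetric_imp_transpose_eq:
  fixes A :: "real^'n^'n"
  assumes "\<And>x y. (A *v x) \<bullet> y = x \<bullet> (A *v y)"
  shows "transpose A = A"
proof -
  have "transpose A *v x = A *v x" for x
  proof -
    have "(transpose A *v x) \<bullet> y = (A *v x) \<bullet> y" for y
      by (metis assms dot_lmul_matrix transpose_matrix_vector)
    then show ?thesis
      by (metis vector_eq_rdot)
  qed
  then show ?thesis
    by (simp add: matrix_eq)
qed

lemma matrix_vector_mult_uminus:
  fixes A :: "'a::ring_1^'n^'m"
  shows "(- A) *v x = - (A *v x)"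
  by (simp add: matrix_vector_mult_def vec_eq_iff sum_negf)

lemma matrix_inv:
  fixes A :: "'a::semiring_1^'n^'m"
  assumes "invertible A"
  shows "A ** matrix_inv A = mat 1" "matrix_inv A ** A = mat 1"
  using someI_ex[OF assms[unfolded invertible_def]] by (auto simp: matrix_inv_def)

text \<open>The part of the spectral theorem that definiteness on invariant subspaces requires: the
quadratic form of a symmetric matrix attains its maximum on the unit sphere of the subspace, and
it does so at an eigenvector.\<close>

lemma Rayleigh_maximum_eigenvector:
  fixes A :: "real^'n^'n"
  assumes sym: "transpose A = A" and S: "subspace S" "S \<noteq> {0}"
    and inv: "\<And>v. v \<in> S \<Longrightarrow> A *v v \<in> S"
  obtains v l where "v \<in> S" "norm v = 1" "A *v v = l *\<^sub>R v"
    "\<And>w. w \<in> S \<Longrightarrow> w \<bullet> (A *v w) \<le> l * (w \<bullet> w)"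
proof -
  let ?K = "S \<inter> sphere 0 1"
  obtain s where s: "s \<in> S" "s \<noteq> 0"
    using S subspace_0 by blast
  have "(1 / norm s) *\<^sub>R s \<in> ?K"
    using s S(1) by (auto simp: subspace_scale)
  then have "?K \<noteq> {}"
    by blast
  moreover have "compact ?K"
    by (simp add: S(1) closed_subspace closed_Int_compact)
  moreover have "continuous_on ?K (\<lambda>w. w \<bullet> (A *v w))"
    by (intro continuous_intros linear_continuous_on matrix_vector_mul_bounded_linear)
  ultimately obtain v where v: "v \<in> ?K" "\<And>w. w \<in> ?K \<Longrightarrow> w \<bullet> (A *v w) \<le> v \<bullet> (A *v v)"
    by (rule_tac continuous_attains_sup[THEN bexE]) blast+
  define l where "l = v \<bullet> (A *v v)"
  have vv: "norm v = 1" "v \<bullet> v = 1" "v \<in> S"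
    using v(1) by (auto simp: norm_eq_1)
  have le: "w \<bullet> (A *v w) \<le> l * (w \<bullet> w)" if "w \<in> S" for w
  proof (cases "w = 0")
    case False
    have "(1 / norm w) *\<^sub>R w \<in> ?K"
      using False that S(1) by (auto simp: subspace_scale)
    from v(2)[OF this] have "(w \<bullet> (A *v w)) / (norm w)\<^sup>2 \<le> l"
      by (simp add: l_def matrix_vector_mult_scaleR power2_eq_square)
    then show ?thesis
      using False by (simp add: divide_le_eq power2_norm_eq_inner)
  qed auto
  define z where "z = A *v v - l *\<^sub>R v"
  have z: "z \<in> S"
    using vv S(1) inv by (auto simp: z_def subspace_diff subspace_scale)
  define q where "q = z \<bullet> (A *v z) - l * (z \<bullet> z)"
  (* The Rayleigh quotient is maximal at v, so its first variation in the direction z vanishes;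
     up to a factor this variation is z \<bullet> z. *)
  have var: "2 * s * (z \<bullet> z) + s\<^sup>2 * q \<le> 0" for s :: real
  proof -
    have "v + s *\<^sub>R z \<in> S"
      using z vv S(1) by (simp add: subspace_add subspace_scale)
    from le[OF this]
    have "(v + s *\<^sub>R z) \<bullet> (A *v v + s *\<^sub>R (A *v z)) \<le> l * ((v + s *\<^sub>R z) \<bullet> (v + s *\<^sub>R z))"
      by (simp add: matrix_vector_right_distrib matrix_vector_mult_scaleR)
    moreover have "v \<bullet> (A *v z) = z \<bullet> (A *v v)"
      by (metis sym symmetric_matrix_inner inner_commute)
    moreover have "z \<bullet> (A *v v) = z \<bullet> z + l * (v \<bullet> z)"
      by (simp add: z_def inner_diff_left inner_diff_right inner_commute algebra_simps)
    ultimately show ?thesis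
      unfolding q_def using vv l_def
      by (simp add: inner_add_left inner_add_right inner_commute power2_eq_square algebra_simps)
  qed
  have "z \<bullet> z = 0"
  proof (rule ccontr)
    assume "z \<bullet> z \<noteq> 0"
    then have zz: "z \<bullet> z > 0"
      using inner_gt_zero_iff by auto
    define s where "s = (z \<bullet> z) / (\<bar>q\<bar> + 1)"
    have s: "s > 0" "s * (\<bar>q\<bar> + 1) = z \<bullet> z"
      using zz by (auto simp: s_def)
    have "s * q \<ge> - (s * \<bar>q\<bar>)"
      using s(1) by (metis abs_ge_minus_self abs_mult abs_of_pos minus_le_iff)
    moreover have "s * \<bar>q\<bar> + s = z \<bullet> z"
      using s(2) by (simp add: algebra_simps)
    ultimately have "2 * (z \<bullet> z) + s * q > 0"
      using s(1) zz by linarith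
    then have "s * (2 * (z \<bullet> z) + s * q) > 0"
      using s by simp
    then show False
      using var[of s] by (simp add: algebra_simps power2_eq_square)
  qed
  then have "A *v v = l *\<^sub>R v"
    by (simp add: z_def)
  with that vv le show thesis
    by blast
qed

lemma orthogonal_comp_invariant:
  fixes A :: "real^'n^'n"
  assumes "transpose A = A" "\<And>v. v \<in> S \<Longrightarrow> A *v v \<in> S" "w \<in> S\<^sup>\<bottom>"
  shows "A *v w \<in> S\<^sup>\<bottom>"
  using assms(2,3)
  by (simp add: orthogonal_comp_def orthogonal_def symmetric_matrix_inner[OF assms(1), symmetric])

lemma subspace_E_plus: "subspace (E_plus P)"
  by (simp add: E_plus_def)

lemma E_plus_invariant:
  assumes "v \<in> E_plus P"
  shows "P *v v \<in> E_plus P"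
  using assms unfolding E_plus_def
proof (induction rule: span_induct_alt)
  case base
  then show ?case
    by (simp add: span_0)
next
  case (step c x y)
  then obtain l where l: "P *v x = l *\<^sub>R x"
    by blast
  have "x \<in> span {x. \<exists>l>0. P *v x = l *\<^sub>R x}"
    using step(1) by (rule span_base)
  then have "(c * l) *\<^sub>R x + P *v y \<in> span {x. \<exists>l>0. P *v x = l *\<^sub>R x}"
    using step(2) by (intro span_add span_scale)
  then show ?case
    by (simp add: matrix_vector_right_distrib matrix_vector_mult_scaleR l)
qed

text \<open>The least eigenvalue on \<open>E_plus P\<close> (the greatest one of \<open>- P\<close>, up to sign) has an eigenvector
\<open>w\<close> in \<open>E_plus P\<close>. Were it not positive, \<open>w\<close> would be orthogonal to all the eigenvectors that
span \<open>E_plus P\<close>, hence to itself.\<close>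

lemma pos_on_E_plus:
  fixes P :: "real^'n^'n"
  assumes sym: "transpose P = P" and v: "v \<in> E_plus P" "v \<noteq> 0"
  shows "v \<bullet> (P *v v) > 0"
proof -
  have symm: "transpose (- P) = - P"
    using sym by (simp add: transpose_def vec_eq_iff)
  have E: "E_plus P \<noteq> {0}"
    using v by blast
  have inv: "(- P) *v w \<in> E_plus P" if "w \<in> E_plus P" for w
    using E_plus_invariant[OF that] by (simp add: matrix_vector_mult_uminus subspace_neg[OF subspace_E_plus])
  obtain w l where w: "w \<in> E_plus P" "norm w = 1" "(- P) *v w = l *\<^sub>R w"
    and max: "\<And>y. y \<in> E_plus P \<Longrightarrow> y \<bullet> ((- P) *v y) \<le> l * (y \<bullet> y)"
    using Rayleigh_maximum_eigenvector[OF symm subspace_E_plus E inv] by blast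
  have Pw: "P *v w = (- l) *\<^sub>R w"
    using w(3) by (simp add: matrix_vector_mult_uminus) (metis minus_minus)
  have "l < 0"
  proof (rule ccontr)
    assume "\<not> l < 0"
    (* Eigenvectors for the eigenvalues -l \<le> 0 and \<mu> > 0 are orthogonal. *)
    have "orthogonal w x" if x: "\<exists>\<mu>>0. P *v x = \<mu> *\<^sub>R x" for x
    proof -
      obtain \<mu> where \<mu>: "\<mu> > 0" "P *v x = \<mu> *\<^sub>R x"
        using x by blast
      have "- l * (w \<bullet> x) = \<mu> * (w \<bullet> x)"
        using symmetric_matrix_inner[OF sym, of w x] Pw \<mu> by simp
      then have "(\<mu> + l) * (w \<bullet> x) = 0"
        by (simp add: algebra_simps)
      then show ?thesis
        using \<mu> \<open>\<not> l < 0\<close> by (auto simp: orthogonal_def)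
    qed
    then have "orthogonal w w"
      by (intro orthogonal_to_span[OF w(1)[unfolded E_plus_def]]) blast
    then show False
      using w(2) by (simp add: orthogonal_self)
  qed
  moreover have "v \<bullet> v > 0"
    using v by simp
  ultimately have "l * (v \<bullet> v) < 0"
    by (simp add: mult_neg_pos)
  then show ?thesis
    using max[OF v(1)] by (simp add: matrix_vector_mult_uminus)
qed

text \<open>An eigenvector of \<open>P\<close> orthogonal to \<open>E_plus P\<close> cannot have a positive eigenvalue, since it
would lie in \<open>E_plus P\<close>; the eigenvalue zero is excluded by invertibility.\<close>

lemma neg_on_orthogonal_E_plus:
  fixes P :: "real^'n^'n"
  assumes sym: "transpose P = P" and P: "invertible P" and v: "v \<in> (E_plus P)\<^sup>\<bottom>" "v \<noteq> 0"
  shows "v \<bullet> (P *v v) < 0"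
proof -
  have E: "(E_plus P)\<^sup>\<bottom> \<noteq> {0}"
    using v by blast
  obtain w l where w: "w \<in> (E_plus P)\<^sup>\<bottom>" "norm w = 1" "P *v w = l *\<^sub>R w"
    and max: "\<And>y. y \<in> (E_plus P)\<^sup>\<bottom> \<Longrightarrow> y \<bullet> (P *v y) \<le> l * (y \<bullet> y)"
    using Rayleigh_maximum_eigenvector[OF sym subspace_orthogonal_comp E
        orthogonal_comp_invariant[OF sym E_plus_invariant]] by blast
  have "\<not> l > 0"
  proof
    assume "l > 0"
    then have "w \<in> E_plus P"
      using w(3) unfolding E_plus_def by (intro span_base) auto
    then have "orthogonal w w"
      using w(1) by (auto simp: orthogonal_comp_def)
    then show False
      using w(2) by (simp add: orthogonal_self)
  qed
  moreover have "l \<noteq> 0"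
  proof
    assume "l = 0"
    then have "P *v w = P *v 0"
      using w(3) by simp
    then have "w = 0"
      using inj_matrix_vector_mult[OF P] by (metis injD)
    then show False
      using w(2) by simp
  qed
  moreover have "v \<bullet> v > 0"
    using v by simp
  ultimately have "l * (v \<bullet> v) < 0"
    by (simp add: mult_neg_pos)
  then show ?thesis
    using max[OF v(1)] by linarith
qed

text \<open>The witness is \<open>2 \<Pi> - 1\<close> with \<open>\<Pi>\<close> the orthogonal projection, written in an orthonormal basis.\<close>

lemma reflection_matrix_exists:
  fixes S :: "(real^'n) set"
  assumes S: "subspace S"
  obtains J :: "real^'n^'n" where "\<And>y. y \<in> S \<Longrightarrow> J *v y = y" "\<And>z. z \<in> S\<^sup>\<bottom> \<Longrightarrow> J *v z = - z"
proof -
  obtain B where B: "B \<subseteq> S" "pairwise orthogonal B" "\<And>x. x \<in> B \<Longrightarrow> norm x = 1"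
    "independent B" "span B = S"
    using orthonormal_basis_subspace[OF S] by metis
  define f where "f x = 2 *\<^sub>R (\<Sum>b\<in>B. (x \<bullet> b) *\<^sub>R b) - x" for x
  have "linear f"
    unfolding f_def
    by (rule linearI) (simp_all add: inner_add_left scaleR_add_left sum.distrib scaleR_sum_right algebra_simps)
  then have J: "matrix f *v x = f x" for x
    by (simp add: matrix_works)
  show thesis
  proof
    fix y assume "y \<in> S"
    then show "matrix f *v y = y"
    proof -
      have "(\<Sum>b\<in>B. (y \<bullet> b) *\<^sub>R b) = y"
        using orthonormal_basis_expand[OF B(2,3)] B(4,5) independent_imp_finite \<open>y \<in> S\<close> by blast
      then show ?thesis
        unfolding J f_def by (simp add: scaleR_2)
    qed
  next
    fix z assume "z \<in> S\<^sup>\<bottom>"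
    then have "z \<bullet> b = 0" if "b \<in> B" for b
      using that B(1) by (auto simp: orthogonal_comp_def orthogonal_def inner_commute)
    then show "matrix f *v z = - z"
      by (simp add: J f_def)
  qed
qed

lemma orthogonal_comp_cases:
  fixes S :: "'a::euclidean_space set"
  assumes "subspace S"
  obtains y z where "x = y + z" "y \<in> S" "z \<in> S\<^sup>\<bottom>"
  using subspace_sum_orthogonal_comp[OF assms] by (metis UNIV_I set_plus_elim)

lemma reflection_commute:
  fixes J A :: "real^'n^'n"
  assumes S: "subspace S" and J: "\<And>y. y \<in> S \<Longrightarrow> J *v y = y" "\<And>z. z \<in> S\<^sup>\<bottom> \<Longrightarrow> J *v z = - z"
    and A: "transpose A = A" "\<And>v. v \<in> S \<Longrightarrow> A *v v \<in> S"
  shows "J ** A = A ** J"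
proof -
  have "J *v (A *v x) = A *v (J *v x)" for x
  proof -
    obtain y z where x: "x = y + z" "y \<in> S" "z \<in> S\<^sup>\<bottom>"
      using orthogonal_comp_cases[OF S] .
    have "A *v z \<in> S\<^sup>\<bottom>"
      using orthogonal_comp_invariant[OF A x(3)] .
    then show ?thesis
      using x J A(2) by (simp add: matrix_vector_right_distrib matrix_vector_mult_diff_distrib)
  qed
  then show ?thesis
    by (simp add: matrix_eq matrix_vector_mul_assoc[symmetric])
qed

lemma reflection_symmetric:
  fixes J :: "real^'n^'n"
  assumes S: "subspace S" and J: "\<And>y. y \<in> S \<Longrightarrow> J *v y = y" "\<And>z. z \<in> S\<^sup>\<bottom> \<Longrightarrow> J *v z = - z"
  shows "transpose J = J"
proof (rule inner_symmetric_imp_transpose_eq)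
  fix x x'
  obtain y z where x: "x = y + z" "y \<in> S" "z \<in> S\<^sup>\<bottom>"
    using orthogonal_comp_cases[OF S] .
  obtain y' z' where x': "x' = y' + z'" "y' \<in> S" "z' \<in> S\<^sup>\<bottom>"
    using orthogonal_comp_cases[OF S] .
  have "y \<bullet> z' = 0" "z \<bullet> y' = 0"
    using x x' by (auto simp: orthogonal_comp_def orthogonal_def inner_commute)
  then show "(J *v x) \<bullet> x' = x \<bullet> (J *v x')"
    using x x' J by (simp add: matrix_vector_right_distrib inner_add_left inner_add_right inner_diff_left inner_diff_right)
qed

lemma transpose_mult_commute:
  fixes A B :: "real^'n^'n"
  assumes "transpose A = A" "transpose B = B" "A ** B = B ** A"
  shows "transpose (A ** B) = A ** B"
  by (simp add: matrix_transpose_mul assms)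

lemma transpose_matrix_inv:
  fixes A :: "real^'n^'n"
  assumes "invertible A" "transpose A = A"
  shows "transpose (matrix_inv A) = matrix_inv A"
proof -
  have "transpose (matrix_inv A) ** A = transpose (A ** matrix_inv A)"
    by (simp add: matrix_transpose_mul assms(2))
  then have left: "transpose (matrix_inv A) ** A = mat 1"
    by (simp add: matrix_inv(1)[OF assms(1)] transpose_mat)
  have "transpose (matrix_inv A) = transpose (matrix_inv A) ** (A ** matrix_inv A)"
    by (simp add: matrix_inv(1)[OF assms(1)])
  also have "\<dots> = matrix_inv A"
    by (simp add: matrix_mul_assoc left)
  finally show ?thesis .
qed

text \<open>The best constant is the least eigenvalue of \<open>Q\<close>.\<close>

lemma pos_def_lower_bound:
  fixes Q :: "real^'n^'n"
  assumes sym: "transpose Q = Q" and pos: "\<And>v. v \<noteq> 0 \<Longrightarrow> v \<bullet> (Q *v v) > 0"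
  obtains c where "c > 0" "\<And>v. c * (v \<bullet> v) \<le> v \<bullet> (Q *v v)"
proof -
  have symm: "transpose (- Q) = - Q"
    using sym by (simp add: transpose_def vec_eq_iff)
  have "(UNIV :: (real^'n) set) \<noteq> {0}"
    using UNIV_not_singleton by blast
  then obtain v l where v: "norm v = 1" "(- Q) *v v = l *\<^sub>R v"
    and max: "\<And>w. w \<bullet> ((- Q) *v w) \<le> l * (w \<bullet> w)"
    using Rayleigh_maximum_eigenvector[OF symm subspace_UNIV] by (metis UNIV_I)
  have "v \<noteq> 0" "v \<bullet> v = 1"
    using v(1) by (auto simp: norm_eq_1)
  moreover have "Q *v v = (- l) *\<^sub>R v"
    using v(2) by (simp add: matrix_vector_mult_uminus) (metis minus_minus)
  then have "v \<bullet> (Q *v v) = - l * (v \<bullet> v)"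
    by simp
  ultimately have "- l > 0"
    using pos by force
  moreover have "- l * (w \<bullet> w) \<le> w \<bullet> (Q *v w)" for w
    using max[of w] by (simp add: matrix_vector_mult_uminus)
  ultimately show thesis
    by (rule that)
qed

text \<open>With \<open>J\<close> the reflection that fixes \<open>E_plus P\<close> and negates its orthogonal complement,
\<open>J ** P\<close> is the absolute value of \<open>P\<close>. The last conclusion is where invariance of \<open>E_plus P\<close>
enters: a symmetric matrix that preserves this space also preserves its complement.\<close>

lemma abs_matrix_exists:
  fixes P :: "real^'n^'n"
  assumes sym: "transpose P = P" and P: "invertible P"
  obtains J c where "transpose J = J" "transpose (J ** P) = J ** P"
    "c > 0" "\<And>v. c * (v \<bullet> v) \<le> v \<bullet> ((J ** P) *v v)"
    "\<And>A :: real^'n^'n. \<lbrakk>transpose A = A; (*v) A ` E_plus P \<subseteq> E_plus P\<rbrakk> \<Longrightarrow> J ** A = A ** J"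
proof -
  obtain J :: "real^'n^'n" where J: "\<And>y. y \<in> E_plus P \<Longrightarrow> J *v y = y"
    "\<And>z. z \<in> (E_plus P)\<^sup>\<bottom> \<Longrightarrow> J *v z = - z"
    using reflection_matrix_exists[OF subspace_E_plus[of P]] by blast
  have Jsym: "transpose J = J"
    using reflection_symmetric[OF subspace_E_plus J] .
  have comm: "J ** A = A ** J" if "transpose A = A" "(*v) A ` E_plus P \<subseteq> E_plus P" for A :: "real^'n^'n"
    using that by (intro reflection_commute[OF subspace_E_plus J]) auto
  have "J ** P = P ** J"
    by (rule comm[OF sym]) (auto simp: E_plus_invariant)
  then have Q: "transpose (J ** P) = J ** P"
    using transpose_mult_commute[OF Jsym sym] by blast
  have pos: "v \<bullet> ((J ** P) *v v) > 0" if "v \<noteq> 0" for v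
  proof -
    obtain y z where v: "v = y + z" "y \<in> E_plus P" "z \<in> (E_plus P)\<^sup>\<bottom>"
      using orthogonal_comp_cases[OF subspace_E_plus] .
    have Pz: "P *v z \<in> (E_plus P)\<^sup>\<bottom>"
      using orthogonal_comp_invariant[OF sym E_plus_invariant v(3)] .
    have "y \<bullet> (P *v z) = 0" "z \<bullet> (P *v y) = 0"
      using v Pz E_plus_invariant[OF v(2)] by (auto simp: orthogonal_comp_def orthogonal_def inner_commute)
    moreover have "v \<bullet> ((J ** P) *v v) = (y - z) \<bullet> (P *v (y + z))"
      using v J symmetric_matrix_inner[OF Jsym, of v "P *v v"]
      by (simp add: matrix_vector_mul_assoc[symmetric] matrix_vector_right_distrib)
    ultimately have eq: "v \<bullet> ((J ** P) *v v) = y \<bullet> (P *v y) - z \<bullet> (P *v z)"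
      by (simp add: matrix_vector_right_distrib inner_diff_left inner_add_right)
    show ?thesis
    proof (cases "y = 0")
      case True
      then show ?thesis
        using eq neg_on_orthogonal_E_plus[OF sym P v(3)] v(1) that by simp
    next
      case False
      then show ?thesis
        using eq pos_on_E_plus[OF sym v(2)] neg_on_orthogonal_E_plus[OF sym P v(3)]
        by (cases "z = 0") auto
    qed
  qed
  obtain c where "c > 0" "\<And>v. c * (v \<bullet> v) \<le> v \<bullet> ((J ** P) *v v)"
    using pos_def_lower_bound[OF Q pos] by blast
  from that[OF Jsym Q this comm] show thesis .
qed

section \<open>Energy of solutions\<close>

text \<open>The inner product of complex vectors is the real part of the Hermitian one. For it a
real matrix acts separately on real and imaginary parts, so that facts on real quadratic forms carry
over.\<close>

lemma inner_complexify:
  fixes A :: "real^'n^'n" and u w :: "complex^'n"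
  shows "u \<bullet> (complexify A *v w) =
    (\<chi> i. Re (u $ i)) \<bullet> (A *v (\<chi> i. Re (w $ i))) + (\<chi> i. Im (u $ i)) \<bullet> (A *v (\<chi> i. Im (w $ i)))"
  by (simp add: inner_vec_def matrix_vector_mult_def inner_complex_def sum.distrib)

lemma inner_complexify_symmetric:
  fixes A :: "real^'n^'n" and u w :: "complex^'n"
  assumes "transpose A = A"
  shows "(complexify A *v u) \<bullet> w = u \<bullet> (complexify A *v w)"
proof -
  have swap: "x \<bullet> (A *v y) = y \<bullet> (A *v x)" for x y
    using symmetric_matrix_inner[OF assms, of y x] by (simp add: inner_commute)
  have "(complexify A *v u) \<bullet> w = w \<bullet> (complexify A *v u)"
    by (rule inner_commute)
  then show ?thesis
    unfolding inner_complexify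
    by (simp only: swap[of "\<chi> i. Re (w $ i)"] swap[of "\<chi> i. Im (w $ i)"])
qed

lemma inner_imaginary_scale:
  fixes u w :: "complex^'n"
  shows "u \<bullet> ((\<i> * complex_of_real t) *s w) = - (((\<i> * complex_of_real t) *s u) \<bullet> w)"
  by (simp add: inner_vec_def inner_complex_def vector_scalar_mult_def sum_negf[symmetric])
    (simp add: algebra_simps)

text \<open>The Hermitian form of a real symmetric matrix takes real values, so it becomes purely imaginary
when multiplied by \<open>\<i> t\<close>.\<close>

lemma inner_imaginary_complexify_symmetric:
  fixes A :: "real^'n^'n" and u :: "complex^'n"
  assumes "transpose A = A"
  shows "u \<bullet> ((\<i> * complex_of_real t) *s (complexify A *v u)) = 0"
proof -
  let ?c = "\<i> * complex_of_real t"
  have "u \<bullet> (?c *s (complexify A *v u)) = (?c *s u) \<bullet> (complexify A *v u)"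
    by (metis inner_commute inner_complexify_symmetric[OF assms] vector_scalar_commute)
  then show ?thesis
    using inner_imaginary_scale[of u t "complexify A *v u"] by simp
qed

lemma complexify_mult:
  fixes A B :: "real^'n^'n"
  shows "complexify (A ** B) = complexify A ** complexify B"
  by (simp add: matrix_matrix_mult_def vec_eq_iff)

lemma complexify_coercive:
  fixes Q :: "real^'n^'n" and u :: "complex^'n"
  assumes "\<And>v. c * (v \<bullet> v) \<le> v \<bullet> (Q *v v)"
  shows "c * (u \<bullet> u) \<le> u \<bullet> (complexify Q *v u)"
proof -
  have "u \<bullet> u = (\<chi> i. Re (u $ i)) \<bullet> (\<chi> i. Re (u $ i)) + (\<chi> i. Im (u $ i)) \<bullet> (\<chi> i. Im (u $ i))"
    by (simp add: inner_vec_def inner_complex_def sum.distrib)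
  then show ?thesis
    using assms[of "\<chi> i. Re (u $ i)"] assms[of "\<chi> i. Im (u $ i)"]
    by (simp add: inner_complexify distrib_left)
qed

lemma mat_vector_mult: "mat k *v x = k *s x" for x :: "'a::semiring_1^'n"
proof -
  have "(if i = j then k else 0) * x $ j = (if i = j then k * x $ j else 0)" for i j
    by simp
  then show ?thesis
    by (simp add: vec_eq_iff matrix_vector_mult_def mat_def)
qed

lemma invertible_if_matrix_le:
  fixes A :: "real^'n^'n"
  assumes "m > 0" "matrix_le (mat m) A"
  shows "invertible A"
proof -
  have "v = 0" if "A *v v = 0" for v
  proof -
    have "0 \<le> v \<bullet> ((A - mat m) *v v)"
      using assms(2) by (simp add: matrix_le_def pos_semidef_def)
    moreover have "mat m *v v = m *\<^sub>R v"
      by (simp add: mat_vector_mult scalar_mult_eq_scaleR)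
    ultimately have "m * (v \<bullet> v) \<le> 0"
      using that by (simp add: matrix_vector_mult_diff_rdistrib)
    then have "v \<bullet> v \<le> 0"
      using assms(1) by (simp add: mult_le_0_iff)
    then show ?thesis
      by (metis inner_gt_zero_iff not_le)
  qed
  then show ?thesis
    by (simp add: invertible_left_inverse matrix_left_invertible_ker)
qed

text \<open>In \<open>J P\<^sub>1 P\<^sub>1\<^sup>-\<^sup>1 (\<i> t H\<^sup>-\<^sup>1 - P\<^sub>0) = \<i> t J H\<^sup>-\<^sup>1 - J P\<^sub>0\<close> the matrix \<open>J H\<^sup>-\<^sup>1\<close> is symmetric, as a
product of commuting symmetric matrices. Its contribution is purely imaginary, and the dependence
on \<open>t\<close> disappears.\<close>

lemma energy_derivative:
  fixes P1 P0 J :: "real^'n^'n" and u :: "complex^'n"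
  assumes P1: "invertible P1" and J: "transpose J = J"
    and H: "transpose (H x) = H x" "invertible (H x)" and comm: "J ** H x = H x ** J"
  shows "u \<bullet> (complexify (J ** P1) *v (ode_coeff P1 P0 H t x *v u)) = - (u \<bullet> (complexify (J ** P0) *v u))"
proof -
  let ?G = "matrix_inv (H x)" and ?c = "\<i> * complex_of_real t"
  have "J ** ?G = ?G ** (H x ** J) ** ?G"
    by (simp add: matrix_mul_assoc matrix_inv(2)[OF H(2)])
  also have "\<dots> = ?G ** J ** (H x ** ?G)"
    by (simp add: comm[symmetric] matrix_mul_assoc)
  finally have "J ** ?G = ?G ** J"
    by (simp add: matrix_inv(1)[OF H(2)])
  then have sym: "transpose (J ** ?G) = J ** ?G"
    using transpose_mult_commute[OF J transpose_matrix_inv[OF H(2,1)]] by blast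
  have "J ** P1 ** matrix_inv P1 = J"
    by (simp add: matrix_mul_assoc[symmetric] matrix_inv(1)[OF P1])
  then have "complexify (J ** P1) ** complexify (matrix_inv P1) = complexify J"
    by (simp add: complexify_mult[symmetric])
  then have "complexify (J ** P1) *v (ode_coeff P1 P0 H t x *v u)
      = complexify J *v ((mat ?c ** complexify ?G - complexify P0) *v u)"
    by (simp add: ode_coeff_def matrix_vector_mul_assoc matrix_mul_assoc)
  also have "\<dots> = complexify J *v (mat ?c *v (complexify ?G *v u)) - complexify J *v (complexify P0 *v u)"
    by (simp add: matrix_vector_mult_diff_rdistrib matrix_vector_mult_diff_distrib matrix_vector_mul_assoc)
  also have "mat ?c *v (complexify ?G *v u) = ?c *s (complexify ?G *v u)"
    by (rule mat_vector_mult)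
  also have "complexify J *v (?c *s (complexify ?G *v u)) - complexify J *v (complexify P0 *v u)
      = ?c *s (complexify (J ** ?G) *v u) - complexify (J ** P0) *v u"
    by (simp add: complexify_mult vector_scalar_commute matrix_vector_mul_assoc)
  finally show ?thesis
    by (simp add: inner_diff_right inner_imaginary_complexify_symmetric[OF sym])
qed

lemma bounded_linear_matrix_vector_mult_left:
  "bounded_linear (\<lambda>M::complex^'n^'n. M *v v)"
proof (rule linear_conv_bounded_linear[THEN iffD1], rule linearI)
  show "(r *\<^sub>R M) *v v = r *\<^sub>R (M *v v)" for r and M :: "complex^'n^'n"
    by (simp add: vec_eq_iff matrix_vector_mult_def scaleR_sum_right)
qed (rule matrix_vector_mult_add_rdistrib)

text \<open>A differential inequality for the energy \<open>u \<bullet> Q u\<close> of the solution \<open>u = \<Phi> v\<close> bounds \<open>\<Phi>\<close> itself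
because the energy is equivalent to the squared norm. The bound depends on the coefficient \<open>A\<close> only
through \<open>L\<close>.\<close>

lemma energy_growth_imp_bound:
  fixes Q :: "real^'n^'n" and \<Phi> A :: "real \<Rightarrow> complex^'n^'n"
  assumes \<Phi>: "fundamental_matrix a b A \<Phi>"
    and Q: "transpose Q = Q" "c > 0" "\<And>v. c * (v \<bullet> v) \<le> v \<bullet> (Q *v v)"
    and K: "\<And>v. norm (complexify Q *v v) \<le> K * norm v"
    and A: "AE x in lebesgue_on {a<..<b}. \<forall>u. u \<bullet> (complexify Q *v (A x *v u)) \<le> L * (u \<bullet> u)" "L \<ge> 0"
    and x: "x \<in> {a..b}"
  shows "norm (\<Phi> x *v v) \<le> sqrt (exp (2 * L / c * (b - a)) * K / c) * norm v"
proof -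
  define f where "f y = (\<Phi> y *v v) \<bullet> (complexify Q *v (\<Phi> y *v v))" for y
  define f' where "f' y = 2 * ((\<Phi> y *v v) \<bullet> (complexify Q *v (A y *v (\<Phi> y *v v))))" for y
  have bl: "bounded_linear (\<lambda>M::complex^'n^'n. M *v v)"
    by (rule bounded_linear_matrix_vector_mult_left)
  have bb: "bounded_bilinear (\<lambda>M N :: complex^'n^'n. (M *v v) \<bullet> (complexify Q *v (N *v v)))"
    by (rule bounded_bilinear.comp[OF bounded_bilinear_inner bl
          bounded_linear_compose[OF matrix_vector_mul_bounded_linear bl]])
  have "absolutely_continuous_on_interval a b f"
    using \<Phi> unfolding f_def fundamental_matrix_def
    by (intro bounded_bilinear.absolutely_continuous_on_interval[OF bb]) auto
  moreover have "AE y in lebesgue_on {a<..<b}. (f has_real_derivative f' y) (at y) \<and> f' y \<le> 2 * L / c * f y"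
  proof -
    have "AE y in lebesgue_on {a<..<b}. (\<Phi> has_vector_derivative A y ** \<Phi> y) (at y)"
      using \<Phi> by (simp add: fundamental_matrix_def)
    with A(1) show ?thesis
    proof eventually_elim
      case (elim y)
      let ?u = "\<Phi> y *v v"
      have "(f has_vector_derivative ?u \<bullet> (complexify Q *v ((A y ** \<Phi> y) *v v))
          + ((A y ** \<Phi> y) *v v) \<bullet> (complexify Q *v ?u)) (at y)"
        unfolding f_def by (rule bounded_bilinear.has_vector_derivative[OF bb elim(2) elim(2)])
      moreover have "((A y ** \<Phi> y) *v v) \<bullet> (complexify Q *v ?u) = ?u \<bullet> (complexify Q *v ((A y ** \<Phi> y) *v v))"
        by (metis inner_commute inner_complexify_symmetric[OF Q(1)])
      ultimately have "(f has_real_derivative f' y) (at y)"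
        by (simp add: has_real_derivative_iff_has_vector_derivative f'_def matrix_vector_mul_assoc)
      moreover have "f' y \<le> 2 * L / c * f y"
      proof -
        have "f' y \<le> 2 * L * (?u \<bullet> ?u)"
          using elim(1) by (simp add: f'_def)
        also have "?u \<bullet> ?u \<le> f y / c"
          using complexify_coercive[OF Q(3), of ?u] Q(2) by (simp add: f_def field_simps)
        finally show ?thesis
          using A(2) by (simp add: mult_left_mono)
      qed
      ultimately show ?case ..
    qed
  qed
  ultimately have fx: "f x \<le> exp (2 * L / c * (x - a)) * f a"
    using x by (rule absolutely_continuous_on_interval_gronwall)
  have "f a = v \<bullet> (complexify Q *v v)"
    using \<Phi> by (simp add: f_def fundamental_matrix_def)
  also have "\<dots> \<le> norm v * norm (complexify Q *v v)"
    by (rule norm_cauchy_schwarz)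
  also have "\<dots> \<le> norm v * (K * norm v)"
    using K by (intro mult_left_mono) auto
  finally have fa: "f a \<le> K * (norm v)\<^sup>2"
    by (simp add: power2_eq_square mult_ac)
  have "0 \<le> c * (v \<bullet> v)"
    using Q(2) by simp
  then have fa0: "0 \<le> f a"
    using complexify_coercive[OF Q(3), of v] \<Phi> by (simp add: f_def fundamental_matrix_def)
  have "c * (norm (\<Phi> x *v v))\<^sup>2 \<le> f x"
    using complexify_coercive[OF Q(3), of "\<Phi> x *v v"] by (simp add: f_def power2_norm_eq_inner)
  also have "\<dots> \<le> exp (2 * L / c * (b - a)) * f a"
  proof -
    have "2 * L / c * (x - a) \<le> 2 * L / c * (b - a)"
      using x Q(2) A(2) by (intro mult_left_mono) auto
    then have "exp (2 * L / c * (x - a)) * f a \<le> exp (2 * L / c * (b - a)) * f a"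
      using fa0 by (intro mult_right_mono) auto
    with fx show ?thesis
      by linarith
  qed
  also have "\<dots> \<le> exp (2 * L / c * (b - a)) * (K * (norm v)\<^sup>2)"
    using fa by (intro mult_left_mono) auto
  finally have "(norm (\<Phi> x *v v))\<^sup>2 \<le> exp (2 * L / c * (b - a)) * K / c * (norm v)\<^sup>2"
    using Q(2) by (simp add: field_simps)
  then have "norm (\<Phi> x *v v) \<le> sqrt (exp (2 * L / c * (b - a)) * K / c * (norm v)\<^sup>2)"
    by (rule real_le_rsqrt)
  then show ?thesis
    unfolding real_sqrt_mult[of _ "(norm v)\<^sup>2"] by simp
qed

section \<open>Uniform boundedness of the fundamental matrices\<close>

theorem theorem6p3:
  fixes a b m :: real
    and P1 P0 :: "real^'n^'n"
    and H :: "real \<Rightarrow> real^'n^'n"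
    and \<Phi> :: "real \<Rightarrow> real \<Rightarrow> complex^'n^'n"
  assumes "a < b"
    and "transpose P1 = P1" and "invertible P1"
    and "P0 = - transpose P0"
    and "Linfty (lebesgue_on {a<..<b}) H"
    and "m > 0"
    and "AE x in lebesgue_on {a<..<b}. transpose (H x) = H x \<and> matrix_le (mat m) (H x)"
    and "\<And>t. fundamental_matrix a b (ode_coeff P1 P0 H t) (\<Phi> t)"
    and "AE x in lebesgue_on {a<..<b}. (\<lambda>v. H x *v v) ` E_plus P1 \<subseteq> E_plus P1"
  shows "(SUP t. matrix_sup_norm a b (\<Phi> t)) < \<infinity>"
proof -
  obtain J c where J: "transpose J = J" and Q: "transpose (J ** P1) = J ** P1"
    "c > 0" "\<And>v. c * (v \<bullet> v) \<le> v \<bullet> ((J ** P1) *v v)"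
    and comm: "\<And>B :: real^'n^'n. \<lbrakk>transpose B = B; (*v) B ` E_plus P1 \<subseteq> E_plus P1\<rbrakk> \<Longrightarrow> J ** B = B ** J"
    using abs_matrix_exists[OF assms(2,3)] by blast
  obtain K where K: "\<And>u :: complex^'n. norm (complexify (J ** P1) *v u) \<le> K * norm u"
    using bounded_linear.bounded[OF matrix_vector_mul_bounded_linear[of "complexify (J ** P1)"]]
    by (auto simp: mult.commute)
  obtain L where L: "L > 0" "\<And>u :: complex^'n. norm (complexify (J ** P0) *v u) \<le> L * norm u"
    using bounded_linear.pos_bounded[OF matrix_vector_mul_bounded_linear[of "complexify (J ** P0)"]]
    by (auto simp: mult.commute)
  (* The constants c, K and L are built from P1 and P0 alone, hence uniform in t. *)
  have coeff: "AE x in lebesgue_on {a<..<b}. \<forall>u. u \<bullet> (complexify (J ** P1) *v (ode_coeff P1 P0 H t x *v u)) \<le> L * (u \<bullet> u)"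
    for t
    using assms(7,9)
  proof eventually_elim
    case (elim x)
    have "invertible (H x)"
      using elim(1) invertible_if_matrix_le[OF assms(6)] by blast
    show ?case
    proof
      fix u :: "complex^'n"
      have "u \<bullet> (complexify (J ** P1) *v (ode_coeff P1 P0 H t x *v u)) = - (u \<bullet> (complexify (J ** P0) *v u))"
        using elim \<open>invertible (H x)\<close> comm by (intro energy_derivative[OF assms(3) J]) auto
      also have "\<dots> \<le> norm u * norm (complexify (J ** P0) *v u)"
        using Cauchy_Schwarz_ineq2[of u "complexify (J ** P0) *v u"] by linarith
      also have "\<dots> \<le> norm u * (L * norm u)"
        using L(2) by (intro mult_left_mono) auto
      finally show "u \<bullet> (complexify (J ** P1) *v (ode_coeff P1 P0 H t x *v u)) \<le> L * (u \<bullet> u)"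
        by (simp add: power2_norm_eq_inner[symmetric] power2_eq_square mult_ac)
    qed
  qed
  define M where "M = sqrt (exp (2 * L / c * (b - a)) * K / c)"
  have "onorm ((*v) (\<Phi> t x)) \<le> M" if "x \<in> {a..b}" for t x
    unfolding M_def
    by (intro onorm_le energy_growth_imp_bound[OF assms(8) Q K coeff _ that]) (use L(1) in simp)
  then have "matrix_sup_norm a b (\<Phi> t) \<le> ereal M" for t
    unfolding matrix_sup_norm_def by (intro SUP_least) simp
  then have "(SUP t. matrix_sup_norm a b (\<Phi> t)) \<le> ereal M"
    by (rule SUP_least)
  also have "\<dots> < \<infinity>"
    by simp
  finally show ?thesis .
qed

end
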